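(* For every finite simple undirected graph $G=(V,E)$: $\mathrm{RTD}(\mathcal{C}_{star}(G)) \le \mathrm{VCD}(\mathcal{C}_{star}(G))$.
   Context: $N_G^o(x)=\{y:\{x,y\}\in E\}$. The concept class $\mathcal{C}_{star}(G)$ over domain $V$ is $\{X\cup\{x\} : x\in V,\ X\subseteq N_G^o(x)\}$. $\mathrm{VCD}$ is the Vapnik–Chervonenkis dimension (largest $S\subseteq V$ such that every $S'\subseteq S$ equals $S\cap C$ for some concept $C$). For a finite concept class $\mathcal{C}$ over a finite domain $\mathcal{X}$, a teaching set for $C\in\mathcal{C}$ is a set $D\subseteq\mathcal{X}$ such that for every $C'\in\mathcal{C}\setminus\{C\}$ there is $x\in D$ with ($x\in C\iff x\notin C'$); $\mathrm{TD}(C,\mathcal{C})$ is the minimum size of such a set, $\mathrm{TD}_{min}(\mathcal{C})=\min_{C}\mathrm{TD}(C,\mathcal{C})$, $\mathcal{C}_{min}=\{C:\mathrm{TD}(C,\mathcal{C})=\mathrm{TD}_{min}(\mathcal{C})\}$, and $\mathrm{RTD}(\mathcal{C})=\mathrm{TD}_{min}(\mathcal{C})$ if $\mathcal{C}=\mathcal{C}_{min}$, otherwise $\mathrm{RTD}(\mathcal{C})=\max\{\mathrm{TD}_{min}(\mathcal{C}),\mathrm{RTD}(\mathcal{C}\setminus\mathcal{C}_{min})\}$. *)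

theory Defs
  imports Complex_Main
begin

locale finite_simple_graph =
  fixes V :: "'a set" and E :: "'a set set"
  assumes finite_V: "finite V"
    and edges: "e \<in> E \<Longrightarrow> e \<subseteq> V \<and> card e = 2"

definition open_nbhd :: "'a set set \<Rightarrow> 'a \<Rightarrow> 'a set" where
  "open_nbhd E x = {y. {x, y} \<in> E}"

definition star_class :: "'a set \<Rightarrow> 'a set set \<Rightarrow> 'a set set" where
  "star_class V E = {X \<union> {x} | X x. x \<in> V \<and> X \<subseteq> open_nbhd E x}"

definition shattered :: "'a set set \<Rightarrow> 'a set \<Rightarrow> bool" where
  "shattered \<C> S \<longleftrightarrow> (\<forall>S' \<subseteq> S. \<exists>C \<in> \<C>. S' = S \<inter> C)"

text \<open>
  In all notions below the first argument \<open>X\<close> is the domain, which is meant to be finite, and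
  \<open>\<C>\<close> is meant to be a class of subsets of \<open>X\<close>. On a nonempty finite set of naturals the
  supremum is the maximum; on the empty set it is 0, so the empty class, which shatters nothing,
  gets dimension 0.
\<close>

definition VCD :: "'a set \<Rightarrow> 'a set set \<Rightarrow> nat" where
  "VCD X \<C> = Sup {card S | S. S \<subseteq> X \<and> shattered \<C> S}"

definition teaching_set :: "'a set \<Rightarrow> 'a set set \<Rightarrow> 'a set \<Rightarrow> 'a set \<Rightarrow> bool" where
  "teaching_set X \<C> C D \<longleftrightarrow>
     D \<subseteq> X \<and> (\<forall>C' \<in> \<C> - {C}. \<exists>x \<in> D. x \<in> C \<longleftrightarrow> x \<notin> C')"

definition TD :: "'a set \<Rightarrow> 'a set set \<Rightarrow> 'a set \<Rightarrow> nat" where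
  "TD X \<C> C = (LEAST n. \<exists>D. teaching_set X \<C> C D \<and> card D = n)"

definition TD_min :: "'a set \<Rightarrow> 'a set set \<Rightarrow> nat" where
  "TD_min X \<C> = Min (TD X \<C> ` \<C>)"

definition easiest :: "'a set \<Rightarrow> 'a set set \<Rightarrow> 'a set set" where
  "easiest X \<C> = {C \<in> \<C>. TD X \<C> C = TD_min X \<C>}"

lemma easiest_subset: "easiest X \<C> \<subseteq> \<C>"
  by (auto simp: easiest_def)

lemma easiest_nonempty:
  assumes "finite \<C>" "\<C> \<noteq> {}"
  shows "easiest X \<C> \<noteq> {}"
proof -
  have "TD_min X \<C> \<in> TD X \<C> ` \<C>"
    unfolding TD_min_def using assms by (intro Min_in) auto
  then show ?thesis
    by (auto simp: easiest_def)
qed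

text \<open>
  The recursion is only meaningful for nonempty finite classes; the value 0 elsewhere is a
  convention. The recursive call never reaches the empty class.
\<close>

function RTD :: "'a set \<Rightarrow> 'a set set \<Rightarrow> nat" where
  "RTD X \<C> =
     (if finite \<C> \<and> \<C> \<noteq> {} then
        if \<C> = easiest X \<C> then TD_min X \<C>
        else max (TD_min X \<C>) (RTD X (\<C> - easiest X \<C>))
      else 0)"
  by pat_completeness auto
termination
proof (relation "measure (\<lambda>(X, \<C>). card \<C>)")
  fix X :: "'a set" and \<C> :: "'a set set"
  assume "finite \<C> \<and> \<C> \<noteq> {}"
  then have "\<C> - easiest X \<C> \<subset> \<C>" "finite \<C>"
    using easiest_subset[of X \<C>] easiest_nonempty[of \<C> X] by auto
  then show "((X, \<C> - easiest X \<C>), (X, \<C>)) \<in> measure (\<lambda>(X, \<C>). card \<C>)"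
    by (simp add: psubset_card_mono)
qed simp

declare RTD.simps [simp del]

end

theory Submission
  imports Defs
begin

text \<open>
  Let \<open>d\<close> be the VC dimension. It suffices that every nonempty subclass \<open>\<A>\<close> has a concept with a
  teaching set of size at most \<open>d\<close>. Open neighbourhoods are shattered, so \<open>|N[x]| \<le> d + 1\<close>; call
  \<open>x\<close> critical if equality holds, and let \<open>P\<close> be the set of twins of \<open>x\<close>, i.e. of \<open>p\<close> with
  \<open>N[p] = N[x]\<close>. Since \<open>N[x]\<close> is not shattered, \<open>N[x] - P\<close> is not the trace of a concept on \<open>N[x]\<close>,
  whereas every concept that contains a twin and \<open>N[x] - P\<close> is centred at a twin. Hence, if \<open>\<A>\<close>
  contains a concept \<open>(N[x] - P) \<union> Q\<close> with \<open>{} \<noteq> Q \<subseteq> P\<close>, the smallest such concept is taught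
  by \<open>N[x] - {q}\<close> for any \<open>q \<in> Q\<close>. If there is none for any critical \<open>x\<close>, then \<open>\<A>\<close> contains no
  \<open>N[x]\<close> of size \<open>d + 1\<close>, and a concept of maximal size in \<open>\<A>\<close> is taught by its own elements.
\<close>

definition closed_nbhd :: "'a set set \<Rightarrow> 'a \<Rightarrow> 'a set" where
  "closed_nbhd E x = insert x (open_nbhd E x)"

definition twins :: "'a set set \<Rightarrow> 'a \<Rightarrow> 'a set" where
  "twins E x = {p. closed_nbhd E p = closed_nbhd E x}"

text \<open>Every class reached by the recursion is a subclass of \<open>\<C>\<close>, so the
  assumption passes down and bounds each \<open>TD_min\<close> in the maximum.\<close>

lemma RTD_le:
  assumes "\<And>\<A>. \<A> \<subseteq> \<C> \<Longrightarrow> \<A> \<noteq> {} \<Longrightarrow> \<exists>C\<in>\<A>. \<exists>D. teaching_set X \<A> C D \<and> card D \<le> k"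
  shows "RTD X \<C> \<le> k"
  using assms
proof (induction X \<C> rule: RTD.induct)
  case (1 X \<C>)
  show ?case
  proof (cases "finite \<C> \<and> \<C> \<noteq> {}")
    case True
    obtain C D where C: "C \<in> \<C>" and D: "teaching_set X \<C> C D" "card D \<le> k"
      using 1(2)[of \<C>] True by auto
    have "TD_min X \<C> \<le> TD X \<C> C"
      unfolding TD_min_def using True C by auto
    also have "\<dots> \<le> card D"
      unfolding TD_def using D by (intro Least_le) auto
    finally have "TD_min X \<C> \<le> k"
      using D by simp
    moreover have "RTD X (\<C> - easiest X \<C>) \<le> k" if "\<C> \<noteq> easiest X \<C>"
      by (rule 1(1)[OF True that]) (rule 1(2); blast)
    ultimately show ?thesis
      using True by (subst RTD.simps) auto
  qed (subst RTD.simps, auto)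
qed

lemma card_le_VCD:
  assumes "finite X" "S \<subseteq> X" "shattered \<C> S"
  shows "card S \<le> VCD X \<C>"
  unfolding VCD_def
proof (rule cSup_upper)
  show "bdd_above {card S |S. S \<subseteq> X \<and> shattered \<C> S}"
    using assms(1) by (auto intro!: bdd_aboveI[of _ "card X"] card_mono)
qed (use assms in auto)

lemma mem_star_class_iff:
  "C \<in> star_class V E \<longleftrightarrow> (\<exists>x\<in>V. x \<in> C \<and> C \<subseteq> closed_nbhd E x)"
proof
  assume "\<exists>x\<in>V. x \<in> C \<and> C \<subseteq> closed_nbhd E x"
  then obtain x where "x \<in> V" "x \<in> C" "C \<subseteq> closed_nbhd E x" by blast
  then show "C \<in> star_class V E"
    unfolding star_class_def closed_nbhd_def
    by (intro CollectI exI[of _ "C - {x}"] exI[of _ x]) auto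
qed (auto simp: star_class_def closed_nbhd_def)

lemma closed_nbhd_self: "x \<in> closed_nbhd E x"
  by (simp add: closed_nbhd_def)

lemma closed_nbhd_sym: "y \<in> closed_nbhd E x \<longleftrightarrow> x \<in> closed_nbhd E y"
  by (auto simp: closed_nbhd_def open_nbhd_def insert_commute)

lemma twins_subset: "twins E x \<subseteq> closed_nbhd E x"
proof
  fix p assume "p \<in> twins E x"
  then show "p \<in> closed_nbhd E x"
    using closed_nbhd_self[of p E] by (simp add: twins_def)
qed

lemma shattered_open_nbhd:
  assumes "x \<in> V" "x \<notin> open_nbhd E x"
  shows "shattered (star_class V E) (open_nbhd E x)"
  unfolding shattered_def
proof (intro allI impI)
  fix S assume "S \<subseteq> open_nbhd E x"
  with assms show "\<exists>C\<in>star_class V E. S = open_nbhd E x \<inter> C"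
    by (intro bexI[of _ "insert x S"]) (auto simp: mem_star_class_iff closed_nbhd_def)
qed

context finite_simple_graph
begin

abbreviation "N \<equiv> closed_nbhd E"
abbreviation "d \<equiv> VCD V (star_class V E)"

lemma closed_nbhd_subset: "x \<in> V \<Longrightarrow> N x \<subseteq> V"
  using edges by (fastforce simp: closed_nbhd_def open_nbhd_def)

lemma finite_closed_nbhd: "x \<in> V \<Longrightarrow> finite (N x)"
  using closed_nbhd_subset finite_V finite_subset by blast

lemma not_mem_open_nbhd: "x \<notin> open_nbhd E x"
  using edges by (fastforce simp: open_nbhd_def)

lemma card_closed_nbhd_le:
  assumes "x \<in> V"
  shows "card (N x) \<le> Suc d"
proof -
  have "open_nbhd E x \<subseteq> V"
    using closed_nbhd_subset[OF assms] by (auto simp: closed_nbhd_def)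
  then have "card (open_nbhd E x) \<le> d"
    using assms finite_V not_mem_open_nbhd by (intro card_le_VCD shattered_open_nbhd)
  then show ?thesis
    using not_mem_open_nbhd finite_closed_nbhd[OF assms] by (simp add: closed_nbhd_def)
qed

text \<open>As \<open>y\<close> lies in \<open>N p = N x\<close> for each twin \<open>p\<close>,
  \<open>N y\<close> contains the twins as well, hence all of \<open>N x\<close>; the bound
  \<open>d + 1\<close> on its size forces equality.\<close>

lemma center_in_twins:
  assumes x: "x \<in> V" "card (N x) = Suc d"
    and y: "y \<in> N x" "N x - twins E x \<subseteq> N y"
  shows "y \<in> twins E x"
proof -
  have yV: "y \<in> V"
    using closed_nbhd_subset x y by blast
  have "twins E x \<subseteq> N y"
  proof
    fix p assume "p \<in> twins E x"
    then have "y \<in> N p"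
      using y by (simp add: twins_def)
    then show "p \<in> N y"
      by (rule iffD1[OF closed_nbhd_sym])
  qed
  with y have "N x \<subseteq> N y" by blast
  moreover have "card (N y) \<le> card (N x)"
    using card_closed_nbhd_le[OF yV] x by simp
  ultimately have "N x = N y"
    using finite_closed_nbhd[OF yV] by (intro card_seteq)
  then show ?thesis by (simp add: twins_def)
qed

text \<open>Otherwise \<open>N x\<close>, with \<open>d + 1\<close> elements, would be shattered:
  subsets meeting the twins are themselves concepts, and the rest are realised from the centre of
  the offending concept.\<close>

lemma nontwins_not_trace:
  assumes x: "x \<in> V" "card (N x) = Suc d" and C: "C \<in> star_class V E"
  shows "N x \<inter> C \<noteq> N x - twins E x"
proof
  assume trace: "N x \<inter> C = N x - twins E x"
  obtain y where y: "y \<in> V" "y \<in> C" "C \<subseteq> N y"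
    using C mem_star_class_iff by metis
  \<comment> \<open>Inside \<open>N x\<close>, the centre \<open>y\<close> would belong to the
    trace, hence be no twin, yet \<open>center_in_twins\<close> makes it one.\<close>
  have y_notin: "y \<notin> N x"
    using center_in_twins[OF x, of y] y trace by blast
  have "shattered (star_class V E) (N x)"
    unfolding shattered_def
  proof (intro allI impI)
    fix S assume S: "S \<subseteq> N x"
    show "\<exists>C\<in>star_class V E. S = N x \<inter> C"
    proof (cases "S \<inter> twins E x = {}")
      case True
      then have "insert y S \<in> star_class V E"
        using S y trace closed_nbhd_self[of y] by (auto simp: mem_star_class_iff intro!: bexI[of _ y])
      then show ?thesis
        using S y_notin by (intro bexI[of _ "insert y S"]) auto
    next
      case False
      then obtain p where p: "p \<in> S" "N p = N x" by (auto simp: twins_def)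
      then have "p \<in> V"
        using S closed_nbhd_subset[OF x(1)] by blast
      then have "S \<in> star_class V E"
        using p S by (auto simp: mem_star_class_iff)
      then show ?thesis using S by blast
    qed
  qed
  then have "card (N x) \<le> d"
    using card_le_VCD finite_V closed_nbhd_subset[OF x(1)] by blast
  with x show False by simp
qed

text \<open>The centre of \<open>C\<close> lies in \<open>N p = N x\<close>, so it is itself a twin
  and \<open>C\<close> stays within \<open>N x\<close>.\<close>

lemma subset_closed_nbhd_if_twin:
  assumes x: "x \<in> V" "card (N x) = Suc d" and C: "C \<in> star_class V E"
    and sub: "N x - twins E x \<subseteq> C" and p: "p \<in> C" "p \<in> twins E x"
  shows "C \<subseteq> N x"
proof -
  obtain y where y: "y \<in> V" "y \<in> C" "C \<subseteq> N y"
    using C mem_star_class_iff by metis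
  have "y \<in> N p"
    using y p closed_nbhd_sym by fast
  then have "y \<in> N x"
    using p by (simp add: twins_def)
  then have "y \<in> twins E x"
    using center_in_twins[OF x] sub y by blast
  then show ?thesis
    using y by (simp add: twins_def)
qed

text \<open>A rival \<open>B\<close> agreeing with \<open>C\<close> on \<open>N x - {q}\<close>
  contains all nontwins, hence by \<open>nontwins_not_trace\<close> some twin, and so stays inside
  \<open>N x\<close>. It can then only be \<open>C\<close> without \<open>q\<close>, against
  minimality.\<close>

lemma teaching_set_near_critical:
  assumes x: "x \<in> V" "card (N x) = Suc d" and A: "\<A> \<subseteq> star_class V E"
    and C: "N x - twins E x \<subset> C" "C \<subseteq> N x"
    and minimal: "\<And>B. B \<in> \<A> \<Longrightarrow> N x - twins E x \<subset> B \<Longrightarrow> \<not> B \<subset> C"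
    and q: "q \<in> C" "q \<in> twins E x"
  shows "teaching_set V \<A> C (N x - {q})"
proof -
  have "\<exists>z\<in>N x - {q}. z \<in> C \<longleftrightarrow> z \<notin> B" if B: "B \<in> \<A>" "B \<noteq> C" for B
  proof (rule ccontr)
    assume "\<not> ?thesis"
    then have agree: "z \<in> B \<longleftrightarrow> z \<in> C" if "z \<in> N x" "z \<noteq> q" for z
      using that by blast
    have BS: "B \<in> star_class V E" using A B by blast
    have sub: "N x - twins E x \<subseteq> B"
      using agree q C by blast
    moreover have "N x \<inter> B \<noteq> N x - twins E x"
      using nontwins_not_trace[OF x BS] .
    ultimately obtain p where p: "p \<in> B" "p \<in> twins E x"
      by blast
    have "B \<subseteq> N x"
      using subset_closed_nbhd_if_twin[OF x BS sub p] .
    then have "B \<subseteq> C"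
      using agree q by blast
    moreover have "N x - twins E x \<subset> B"
      using sub p by blast
    ultimately show False
      using minimal B by blast
  qed
  then show ?thesis
    unfolding teaching_set_def using closed_nbhd_subset[OF x(1)] by blast
qed

lemma exists_small_teaching_set:
  assumes A: "\<A> \<subseteq> star_class V E" "\<A> \<noteq> {}"
  shows "\<exists>C\<in>\<A>. \<exists>D. teaching_set V \<A> C D \<and> card D \<le> d"
proof -
  have finA: "finite \<A>"
  proof (rule finite_subset)
    show "\<A> \<subseteq> Pow V"
      using A closed_nbhd_subset by (fastforce simp: mem_star_class_iff)
  qed (simp add: finite_V)
  show ?thesis
  proof (cases "\<exists>x\<in>V. card (N x) = Suc d \<and> (\<exists>C\<in>\<A>. N x - twins E x \<subset> C \<and> C \<subseteq> N x)")
    case True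
    then obtain x where x: "x \<in> V" "card (N x) = Suc d"
      and ex: "{C \<in> \<A>. N x - twins E x \<subset> C \<and> C \<subseteq> N x} \<noteq> {}" (is "?M \<noteq> {}")
      by auto
    obtain C where C: "C \<in> ?M" and min: "\<And>B. B \<in> ?M \<Longrightarrow> B \<subseteq> C \<Longrightarrow> C = B"
      using finite_has_minimal[of ?M] finA ex by auto
    obtain q where q: "q \<in> C" "q \<in> twins E x"
      using C by blast
    \<comment> \<open>\<open>B \<subset> C\<close> already puts \<open>B\<close> inside
      \<open>N x\<close>, hence in \<open>?M\<close>.\<close>
    have "\<not> B \<subset> C" if "B \<in> \<A>" "N x - twins E x \<subset> B" for B
      using min[of B] that C by blast
    then have "teaching_set V \<A> C (N x - {q})"
      using C q by (intro teaching_set_near_critical x A(1)) auto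
    moreover have "card (N x - {q}) = d"
      using x subsetD[OF twins_subset q(2)] by simp
    ultimately show ?thesis
      using C by (intro bexI[of _ C] exI[of _ "N x - {q}"]) auto
  next
    case False
    obtain C where C: "C \<in> \<A>" and max: "\<And>B. B \<in> \<A> \<Longrightarrow> C \<subseteq> B \<Longrightarrow> C = B"
      using finite_has_maximal[OF finA A(2)] by auto
    obtain x where x: "x \<in> V" "x \<in> C" "C \<subseteq> N x"
      using C A mem_star_class_iff by (metis subsetD)
    have "teaching_set V \<A> C C"
      unfolding teaching_set_def using max x closed_nbhd_subset[OF x(1)] by blast
    moreover have "card C \<le> d"
    proof (rule ccontr)
      \<comment> \<open>Then \<open>C\<close> is all of \<open>N x\<close>, which properly contains
        \<open>N x - twins E x\<close> because \<open>x\<close> is its own twin; this is the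
        excluded case.\<close>
      assume "\<not> card C \<le> d"
      then have "card (N x) \<le> card C" "card (N x) = Suc d"
        using card_closed_nbhd_le[OF x(1)] card_mono[OF finite_closed_nbhd[OF x(1)] x(3)] by auto
      moreover from this have "C = N x"
        using card_seteq[OF finite_closed_nbhd[OF x(1)] x(3)] by simp
      moreover have "x \<in> twins E x" by (simp add: twins_def)
      ultimately show False
        using False C x by blast
    qed
    ultimately show ?thesis using C by blast
  qed
qed

end

theorem theorem4:
  fixes V :: "'a set" and E :: "'a set set"
  assumes "finite_simple_graph V E"
  shows "RTD V (star_class V E) \<le> VCD V (star_class V E)"
  by (rule RTD_le) (rule finite_simple_graph.exists_small_teaching_set[OF assms])

end
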